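(* For any skew-symmetric matrix $S\in\mathbb R^{3\times3}$ and any bounded connected set $\mathcal G\subset\mathcal L$ (with $\mathcal L$ the FCC lattice), the optimal grain energy $\mathcal E_{\mathcal G}(S)$ satisfies $$\mathcal E_{\mathcal G}(S)\le 6\,|E_1^{\mathrm b}(\mathcal G)|.$$
   Context: **Lattice.** $\mathcal L=\{n_1b_1+n_2b_2+n_3b_3:\ n\in\mathbb Z^3\}\subset\mathbb R^3$ is the face-centered cubic lattice with $b_1=\frac1{\sqrt2}(0,1,1)$, $b_2=\frac1{\sqrt2}(1,0,1)$, $b_3=\frac1{\sqrt2}(1,1,0)$. Write $x\sim y$ if $x,y\in\mathcal L$ and $|x-y|=1$. Connectedness refers to the nearest neighbor graph. $E_1$ is the set of ordered nearest neighbor pairs. For $N\ge1$, $\Lambda=\Lambda^{(N)}=\{n_1b_1+n_2b_2+n_3b_3:\ n_i=\lfloor -N/2+1\rfloor,\ldots,\lfloor N/2\rfloor,\ i=1,2,3\}$; the limit $\Lambda\to\mathcal L$ means $N\to\infty$. **Ariza-Ortiz energy.** A displacement is $u:\mathcal L\to\mathbb R^3$ with $u(x)=0$ for $x\notin\Lambda$. A (lattice-valued) slip field is $\sigma:E_1\to\mathcal L$ with $\sigma(x,y)=-\sigma(y,x)$ and $\sigma(x,y)=0$ if $x,y\notin\Lambda$. The energy is $$H_{\mathrm{AO}}(u,\sigma)=\frac12\sum_{x\sim y}\big[(u(y)-u(x)-\sigma(x,y))\cdot(y-x)\big]^2,$$ summed over unordered nearest neighbor pairs. **Grain boundary.** $E_1^{\mathrm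 b}(\mathcal G)=\{(x,x')\in E_1:\ \{x,x'\}\cap\mathcal G\ne\emptyset\ \text{and}\ \{x,x'\}\cap\mathcal G^c\neq\emptyset\}$, and $|E_1^{\mathrm b}(\mathcal G)|$ denotes the number of its elements modulo orientation. **Optimal grain energy.** For $\tau\in\mathbb R^3$ let $u_S(x)=Sx+\tau$ if $x\in\mathcal G$ and $u_S(x)=0$ otherwise. For $\epsilon>0$ (and $\Lambda\supset\mathcal G$), $\mathcal M_S^{(\epsilon)}(\mathcal G)$ is the set of lattice-valued slip fields $\sigma$ with $\mathrm{supp}\,\sigma\subseteq E_1^{\mathrm b}(\mathcal G)$ for which there exists $\tau$ such that $(\sigma,\tau)$ realizes, within precision $\epsilon$, the infimum of $H_{\mathrm{AO}}(u_S,\sigma)$ over all $\tau\in\mathbb R^3$ and all lattice-valued slip fields $\sigma$ with $\mathrm{supp}\,\sigma\subseteq E_1^{\mathrm b}(\mathcal G)$. Then $$\mathcal E_{\mathcal G}(S):=\liminf_{\Lambda\to\mathcal L}\ \lim_{\epsilon\to0^+}\ \inf_{\sigma\in\mathcal M_S^{(\epsilon)}(\mathcal G)}\ \inf_u H_{\mathrm{AO}}(u,\sigma),$$ where $\inf_u$ is over displacements satisfying the Dirichlet condition on $\Lambda$. *)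

theory Defs
  imports "HOL-Analysis.Analysis"
begin

definition b1 :: "real^3" where "b1 = (1 / sqrt 2) *\<^sub>R vector [0, 1, 1]"
definition b2 :: "real^3" where "b2 = (1 / sqrt 2) *\<^sub>R vector [1, 0, 1]"
definition b3 :: "real^3" where "b3 = (1 / sqrt 2) *\<^sub>R vector [1, 1, 0]"

definition lattice_point :: "int \<Rightarrow> int \<Rightarrow> int \<Rightarrow> real^3" where
  "lattice_point n1 n2 n3 =
     of_int n1 *\<^sub>R b1 + of_int n2 *\<^sub>R b2 + of_int n3 *\<^sub>R b3"

definition fcc :: "(real^3) set" where
  "fcc = {lattice_point n1 n2 n3 | n1 n2 n3. True}"

definition Lambda_box :: "nat \<Rightarrow> (real^3) set" where
  "Lambda_box N = (let I = {\<lfloor>- real N / 2 + 1\<rfloor> .. \<lfloor>real N / 2\<rfloor>}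
            in {lattice_point n1 n2 n3 | n1 n2 n3. n1 \<in> I \<and> n2 \<in> I \<and> n3 \<in> I})"

definition E1 :: "((real^3) \<times> (real^3)) set" where
  "E1 = {(x, y). x \<in> fcc \<and> y \<in> fcc \<and> norm (x - y) = 1}"

definition nn_connected :: "(real^3) set \<Rightarrow> bool" where
  "nn_connected G \<longleftrightarrow> (\<forall>x\<in>G. \<forall>y\<in>G. (x, y) \<in> (E1 \<inter> G \<times> G)\<^sup>*)"

text \<open>Functions on the lattice and on the set of ordered nearest neighbour pairs are
  represented by total functions that vanish elsewhere.\<close>

definition displacements :: "(real^3) set \<Rightarrow> (real^3 \<Rightarrow> real^3) set" where
  "displacements \<Lambda> = {u. \<forall>x. x \<notin> \<Lambda> \<longrightarrow> u x = 0}"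

definition slip_fields :: "(real^3) set \<Rightarrow> ((real^3) \<times> (real^3) \<Rightarrow> real^3) set" where
  "slip_fields \<Lambda> = {\<sigma>.
     (\<forall>e. e \<notin> E1 \<longrightarrow> \<sigma> e = 0) \<and>
     (\<forall>(x, y)\<in>E1. \<sigma> (x, y) \<in> fcc \<and> \<sigma> (x, y) = - \<sigma> (y, x) \<and>
        (x \<notin> \<Lambda> \<and> y \<notin> \<Lambda> \<longrightarrow> \<sigma> (x, y) = 0))}"

text \<open>The energy has a prefactor 1/2 and sums over unordered pairs. The summand is symmetric
  under exchange of the endpoints, so the sum below over ordered pairs counts every unordered
  pair twice, whence 1/4. For displacements and slip fields on a finite \<open>\<Lambda>\<close> only finitely
  many terms are nonzero.\<close>

definition H_AO :: "(real^3 \<Rightarrow> real^3) \<Rightarrow> ((real^3) \<times> (real^3) \<Rightarrow> real^3) \<Rightarrow> real" where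
  "H_AO u \<sigma> = 1 / 4 * (\<Sum>\<^sub>\<infinity>(x, y)\<in>E1. ((u y - u x - \<sigma> (x, y)) \<bullet> (y - x))\<^sup>2)"

definition E1b :: "(real^3) set \<Rightarrow> ((real^3) \<times> (real^3)) set" where
  "E1b G = {(x, x'). (x, x') \<in> E1 \<and> {x, x'} \<inter> G \<noteq> {} \<and> {x, x'} \<inter> - G \<noteq> {}}"

definition boundary_size :: "(real^3) set \<Rightarrow> nat" where
  "boundary_size G = card {{x, x'} | x x'. (x, x') \<in> E1b G}"

definition u_grain :: "real^3^3 \<Rightarrow> (real^3) set \<Rightarrow> real^3 \<Rightarrow> real^3 \<Rightarrow> real^3" where
  "u_grain S G \<tau> x = (if x \<in> G then S *v x + \<tau> else 0)"

definition boundary_slips ::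
  "(real^3) set \<Rightarrow> (real^3) set \<Rightarrow> ((real^3) \<times> (real^3) \<Rightarrow> real^3) set" where
  "boundary_slips \<Lambda> G = {\<sigma> \<in> slip_fields \<Lambda>. {e \<in> E1. \<sigma> e \<noteq> 0} \<subseteq> E1b G}"

text \<open>The real infimum is taken over a nonempty set of nonnegative numbers (the zero slip
  field is admissible).\<close>

definition near_optimal_slips ::
  "(real^3) set \<Rightarrow> real^3^3 \<Rightarrow> (real^3) set \<Rightarrow> real \<Rightarrow> ((real^3) \<times> (real^3) \<Rightarrow> real^3) set" where
  "near_optimal_slips \<Lambda> S G \<epsilon> = {\<sigma> \<in> boundary_slips \<Lambda> G.
     \<exists>\<tau>. H_AO (u_grain S G \<tau>) \<sigma>
         \<le> (INF (\<tau>', \<sigma>') \<in> UNIV \<times> boundary_slips \<Lambda> G. H_AO (u_grain S G \<tau>') \<sigma>') + \<epsilon>}"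

text \<open>The limit exists in the extended reals because the near-optimal slip fields shrink as
  \<open>\<epsilon>\<close> decreases. Boxes that do not contain the bounded set \<open>G\<close> are finitely
  many and do not affect the limit inferior.\<close>

definition optimal_grain_energy :: "(real^3) set \<Rightarrow> real^3^3 \<Rightarrow> ereal" where
  "optimal_grain_energy G S =
     liminf (\<lambda>N. Lim (at_right 0) (\<lambda>\<epsilon>.
       INF \<sigma> \<in> near_optimal_slips (Lambda_box N) S G \<epsilon>.
         INF u \<in> displacements (Lambda_box N). ereal (H_AO u \<sigma>)))"

end

theory Submission imports Defs begin

text \<open>
  Since \<open>S\<close> is skew-symmetric, \<open>u\<^sub>S\<close> costs no energy on edges inside \<open>\<G>\<close>, so only boundary edges
  matter. On a boundary edge with unit vector \<open>e\<close> the slip may be any integer multiple of \<open>e\<close>, so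
  rounding brings the residual down to \<open>1/2\<close>; hence the infimum defining near-optimality is at most
  \<open>1/8\<close> per boundary edge. A near-optimal slip field comes with the competitor \<open>u\<^sub>S\<close>
  itself, whose energy exceeds this infimum by at most \<open>\<epsilon>\<close>.
\<close>

section \<open>The lattice\<close>

lemma lattice_point_diff:
  "lattice_point a b c - lattice_point a' b' c' = lattice_point (a - a') (b - b') (c - c')"
  by (simp add: lattice_point_def algebra_simps)

lemma lattice_point_scale:
  "of_int k *\<^sub>R lattice_point a b c = lattice_point (k * a) (k * b) (k * c)"
  by (simp add: lattice_point_def algebra_simps)

lemma fcc_diff: "x \<in> fcc \<Longrightarrow> y \<in> fcc \<Longrightarrow> x - y \<in> fcc"
  unfolding fcc_def using lattice_point_diff by blast

lemma fcc_scale_int: "x \<in> fcc \<Longrightarrow> of_int k *\<^sub>R x \<in> fcc"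
  unfolding fcc_def using lattice_point_scale by blast

lemma zero_in_fcc: "0 \<in> fcc"
  unfolding fcc_def lattice_point_def by (intro CollectI exI[of _ 0]) simp

text \<open>Each coordinate of a lattice point is a sum of two coefficients over
  \<open>sqrt 2\<close>, so a coefficient is recovered as two coordinates minus the third, over
  \<open>sqrt 2\<close>. The factor 3 is the triangle inequality, with the division by
  \<open>sqrt 2\<close> dropped.\<close>

lemma abs_coefficient_le:
  fixes p q r z :: real
  assumes "\<bar>p\<bar> \<le> R" "\<bar>q\<bar> \<le> R" "\<bar>r\<bar> \<le> R" and "z = (p + q - r) / sqrt 2"
  shows "\<bar>z\<bar> \<le> 3 * R"
proof -
  have "\<bar>z\<bar> = \<bar>p + q - r\<bar> / sqrt 2"
    using assms(4) by simp
  also have "\<dots> \<le> \<bar>p + q - r\<bar> / 1"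
    by (intro divide_left_mono) auto
  also have "\<dots> = \<bar>p + q - r\<bar>"
    by simp
  finally show ?thesis
    using assms(1-3) by linarith
qed

lemma abs_coefficients_le_norm:
  assumes "norm (lattice_point a b c) \<le> R"
  shows "real_of_int \<bar>a\<bar> \<le> 3 * R" "real_of_int \<bar>b\<bar> \<le> 3 * R" "real_of_int \<bar>c\<bar> \<le> 3 * R"
proof -
  let ?x = "lattice_point a b c"
  have x: "?x $ 1 = (1 / sqrt 2) * (b + c)" "?x $ 2 = (1 / sqrt 2) * (a + c)"
    "?x $ 3 = (1 / sqrt 2) * (a + b)"
    by (simp_all add: lattice_point_def b1_def b2_def b3_def field_simps)
  have le: "\<bar>?x $ i\<bar> \<le> R" for i
    using component_le_norm_cart[of ?x i] assms by linarith
  \<comment> \<open>The subtracted coordinate, here the first, is the one in which \<open>a\<close>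
    does not occur.\<close>
  show "real_of_int \<bar>a\<bar> \<le> 3 * R"
    using abs_coefficient_le[OF le[of 2] le[of 3] le[of 1], of "real_of_int a"] x
    by (simp add: field_simps)
  show "real_of_int \<bar>b\<bar> \<le> 3 * R"
    using abs_coefficient_le[OF le[of 1] le[of 3] le[of 2], of "real_of_int b"] x
    by (simp add: field_simps)
  show "real_of_int \<bar>c\<bar> \<le> 3 * R"
    using abs_coefficient_le[OF le[of 1] le[of 2] le[of 3], of "real_of_int c"] x
    by (simp add: field_simps)
qed

lemma finite_Lambda_box: "finite (Lambda_box N)"
proof -
  define I where "I = {\<lfloor>- real N / 2 + 1\<rfloor> .. \<lfloor>real N / 2\<rfloor>}"
  have "Lambda_box N = (\<lambda>(a, b, c). lattice_point a b c) ` (I \<times> I \<times> I)"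
    unfolding Lambda_box_def I_def[symmetric] Let_def by force
  moreover have "finite I" by (simp add: I_def)
  ultimately show ?thesis by simp
qed

lemma bounded_fcc_subset_Lambda_box:
  assumes "G \<subseteq> fcc" "bounded G"
  shows "\<forall>\<^sub>F N in sequentially. G \<subseteq> Lambda_box N"
proof -
  obtain R where R: "\<And>x. x \<in> G \<Longrightarrow> norm x \<le> R"
    using \<open>bounded G\<close> unfolding bounded_iff by blast
  \<comment> \<open>The lower end of the index range is the tighter one:
    \<open>- real N / 2 + 1\<close> has to lie below \<open>- 3 * R\<close>.\<close>
  have "\<forall>\<^sub>F N in sequentially. 6 * R + 2 \<le> real N"
    using filterlim_real_sequentially by (simp add: filterlim_at_top)
  then show ?thesis
  proof eventually_elim
    case (elim N)
    have I: "n \<in> {\<lfloor>- real N / 2 + 1\<rfloor> .. \<lfloor>real N / 2\<rfloor>}" if "real_of_int \<bar>n\<bar> \<le> 3 * R" for n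
    proof -
      have "- real N / 2 + 1 \<le> of_int n" "of_int n \<le> real N / 2"
        using that elim by linarith+
      then show ?thesis
        by (simp add: le_floor_iff floor_le_iff)
    qed
    show ?case
    proof
      fix x assume "x \<in> G"
      then obtain a b c where x: "x = lattice_point a b c"
        using assms(1) unfolding fcc_def by blast
      note abs_coefficients_le_norm[OF R[OF \<open>x \<in> G\<close>, unfolded x], THEN I]
      then show "x \<in> Lambda_box N"
        unfolding Lambda_box_def Let_def x by blast
    qed
  qed
qed

lemma finite_bounded_fcc:
  assumes "G \<subseteq> fcc" "bounded G"
  shows "finite G"
proof -
  obtain N where "G \<subseteq> Lambda_box N"
    using eventually_happens[OF bounded_fcc_subset_Lambda_box[OF assms]] by auto
  then show ?thesis
    using finite_Lambda_box finite_subset by blast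
qed

section \<open>Boundary edges\<close>

text \<open>One endpoint lies in \<open>G\<close> and the edge has length one, so the other endpoint
  is in the ball enlarged by 1, which contains finitely many lattice points.\<close>

lemma finite_E1b:
  assumes "bounded G"
  shows "finite (E1b G)"
proof -
  obtain R where R: "\<And>x. x \<in> G \<Longrightarrow> norm x \<le> R"
    using \<open>bounded G\<close> unfolding bounded_iff by blast
  let ?F = "fcc \<inter> cball 0 (R + 1)"
  have "E1b G \<subseteq> ?F \<times> ?F"
  proof clarify
    fix x y assume xy: "(x, y) \<in> E1b G"
    then have "x \<in> fcc" "y \<in> fcc" "norm (x - y) = 1" "x \<in> G \<or> y \<in> G"
      by (auto simp: E1b_def E1_def)
    moreover have "norm x \<le> norm y + norm (x - y)" "norm y \<le> norm x + norm (x - y)"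
      by norm+
    ultimately show "x \<in> ?F \<and> y \<in> ?F"
      using R[of x] R[of y] by auto
  qed
  moreover have "finite ?F"
    by (rule finite_bounded_fcc) (auto intro: bounded_subset[OF bounded_cball])
  ultimately show ?thesis
    by (meson finite_SigmaI finite_subset)
qed

lemma E1_swap: "(x, y) \<in> E1 \<Longrightarrow> (y, x) \<in> E1"
  by (auto simp: E1_def norm_minus_commute)

lemma E1b_swap: "(x, y) \<in> E1b G \<Longrightarrow> (y, x) \<in> E1b G"
  using E1_swap by (auto simp: E1b_def)

text \<open>The energy sums over ordered pairs, the boundary size counts edges modulo orientation.
  Orienting every boundary edge out of \<open>G\<close> picks one ordered pair per edge, and
  swapping gives the rest.\<close>

lemma card_E1b_le:
  assumes "bounded G"
  shows "card (E1b G) \<le> 2 * boundary_size G"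
proof -
  let ?P = "E1b G \<inter> G \<times> - G"
  let ?e = "\<lambda>(x, y). {x, y}"
  have fin: "finite ?P"
    using finite_E1b[OF assms] by blast
  have "E1b G \<subseteq> ?P \<union> prod.swap ` ?P"
  proof (rule subrelI)
    fix x y assume xy: "(x, y) \<in> E1b G"
    then have "(x, y) \<in> ?P \<or> (y, x) \<in> ?P"
      using E1b_swap[OF xy] by (auto simp: E1b_def)
    then show "(x, y) \<in> ?P \<union> prod.swap ` ?P"
      by force
  qed
  then have "card (E1b G) \<le> card (?P \<union> prod.swap ` ?P)"
    using fin by (intro card_mono) auto
  also have "\<dots> \<le> card ?P + card (prod.swap ` ?P)"
    by (rule card_Un_le)
  also have "\<dots> \<le> 2 * card ?P"
    using card_image_le[OF fin, of prod.swap] by simp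
  \<comment> \<open>Forgetting the orientation is injective here: the endpoint in \<open>G\<close>
    must be the first one.\<close>
  also have "card ?P = card (?e ` ?P)"
    by (rule card_image[symmetric]) (auto simp: inj_on_def doubleton_eq_iff)
  also have "card (?e ` ?P) \<le> boundary_size G"
  proof -
    have "{{x, x'} | x x'. (x, x') \<in> E1b G} = ?e ` E1b G"
      by force
    then show ?thesis
      unfolding boundary_size_def using finite_E1b[OF assms] by (auto intro!: card_mono)
  qed
  finally show ?thesis
    by simp
qed

section \<open>Energy of the rotated grain\<close>

lemma H_AO_nonneg: "0 \<le> H_AO u \<sigma>"
  unfolding H_AO_def by (auto intro!: mult_nonneg_nonneg infsum_nonneg)

lemma skew_inner_eq_0:
  fixes S :: "real^'n^'n"
  assumes "transpose S = - S"
  shows "(S *v v) \<bullet> v = 0"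
proof -
  have "(S *v v) \<bullet> v = (transpose S *v v) \<bullet> v"
    by (metis dot_lmul_matrix inner_commute transpose_matrix_vector)
  \<comment> \<open>Subtracting from the zero matrix turns \<open>(- S) *v v\<close> into
    \<open>- (S *v v)\<close>.\<close>
  also have "\<dots> = - ((S *v v) \<bullet> v)"
    using matrix_vector_mult_diff_rdistrib[of 0 S v] by (simp add: assms)
  finally show ?thesis by simp
qed

text \<open>The rounded quantity is symmetric under exchange of the endpoints, which makes the field
  antisymmetric even though \<open>round\<close> is not an odd function.\<close>

definition rounded_slip ::
  "(real^3) set \<Rightarrow> (real^3 \<Rightarrow> real^3) \<Rightarrow> (real^3) \<times> (real^3) \<Rightarrow> real^3" where
  "rounded_slip G u = (\<lambda>(x, y). if (x, y) \<in> E1b G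
     then of_int (round ((u y - u x) \<bullet> (y - x))) *\<^sub>R (y - x) else 0)"

lemma rounded_slip_in_boundary_slips:
  assumes "G \<subseteq> \<Lambda>"
  shows "rounded_slip G u \<in> boundary_slips \<Lambda> G"
proof -
  have fcc: "rounded_slip G u (x, y) \<in> fcc" for x y
    by (auto simp: rounded_slip_def zero_in_fcc E1b_def E1_def intro!: fcc_scale_int fcc_diff)
  have antisym: "rounded_slip G u (x, y) = - rounded_slip G u (y, x)" for x y
  proof (cases "(x, y) \<in> E1b G")
    case True
    have "(u y - u x) \<bullet> (y - x) = (u x - u y) \<bullet> (x - y)"
      by (simp add: inner_diff_left inner_diff_right)
    then show ?thesis
      using True E1b_swap[OF True] by (simp add: rounded_slip_def flip: scaleR_minus_right)
  next
    case False
    then show ?thesis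
      using E1b_swap[of y x G] by (auto simp: rounded_slip_def)
  qed
  have support: "rounded_slip G u e = 0" if "e \<notin> E1b G" for e
    using that by (auto simp: rounded_slip_def split: prod.splits)
  have "rounded_slip G u e = 0" if "e \<notin> E1" for e
    using that by (intro support) (auto simp: E1b_def)
  \<comment> \<open>A boundary edge touches \<open>G\<close>, hence \<Lambda>.\<close>
  moreover have outside: "rounded_slip G u (x, y) = 0" if "x \<notin> \<Lambda>" "y \<notin> \<Lambda>" for x y
    using assms that by (intro support) (auto simp: E1b_def)
  moreover have "\<forall>(x, y)\<in>E1. rounded_slip G u (x, y) \<in> fcc \<and>
      rounded_slip G u (x, y) = - rounded_slip G u (y, x) \<and>
      (x \<notin> \<Lambda> \<and> y \<notin> \<Lambda> \<longrightarrow> rounded_slip G u (x, y) = 0)"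
    by clarify (intro conjI impI fcc antisym outside; blast)
  moreover have "{e \<in> E1. rounded_slip G u e \<noteq> 0} \<subseteq> E1b G"
    using support by blast
  ultimately show ?thesis
    unfolding boundary_slips_def slip_fields_def by blast
qed

text \<open>The constant 1/8 is the squared residual 1/4, times two ordered pairs per edge, times
  the prefactor 1/4 of \<open>H_AO\<close>.\<close>

lemma H_AO_rounded_slip_le:
  fixes \<tau> :: "real^3"
  assumes "transpose S = - S" "bounded G"
  defines "u \<equiv> u_grain S G \<tau>"
  shows "H_AO u (rounded_slip G u) \<le> real (boundary_size G) / 8"
proof -
  let ?\<sigma> = "rounded_slip G u"
  let ?f = "\<lambda>(x, y). ((u y - u x - ?\<sigma> (x, y)) \<bullet> (y - x))\<^sup>2"
  have interior: "?f (x, y) = 0" if "(x, y) \<in> E1 - E1b G" for x y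
  proof -
    have *: "x \<in> G \<longleftrightarrow> y \<in> G" and "?\<sigma> (x, y) = 0"
      using that by (auto simp: E1b_def rounded_slip_def)
    moreover have "(u y - u x) \<bullet> (y - x) = 0"
    proof (cases "x \<in> G")
      case True
      \<comment> \<open>The translation \<tau> cancels in the difference.\<close>
      then have "u y - u x = S *v (y - x)"
        using * by (simp add: u_def u_grain_def matrix_vector_mult_diff_distrib)
      then show ?thesis
        by (simp add: skew_inner_eq_0[OF assms(1)])
    qed (use * in \<open>simp add: u_def u_grain_def\<close>)
    ultimately show ?thesis by simp
  qed
  have edge: "?f (x, y) \<le> 1 / 4" if "(x, y) \<in> E1b G" for x y
  proof -
    let ?t = "(u y - u x) \<bullet> (y - x)"
    have "norm (y - x) = 1"
      using that by (auto simp: E1b_def E1_def norm_minus_commute)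
    then have "(y - x) \<bullet> (y - x) = 1"
      by (simp add: dot_square_norm)
    \<comment> \<open>As \<open>y - x\<close> is a unit vector, pairing the slip with it returns
      exactly the rounded integer.\<close>
    then have "(u y - u x - ?\<sigma> (x, y)) \<bullet> (y - x) = ?t - of_int (round ?t)"
      using that unfolding inner_diff_left[of "u y - u x"] by (simp add: rounded_slip_def)
    moreover have "\<bar>?t - of_int (round ?t)\<bar> \<le> 1 / 2"
      using of_int_round_abs_le[of ?t] by (simp add: abs_minus_commute)
    ultimately have "((u y - u x - ?\<sigma> (x, y)) \<bullet> (y - x))\<^sup>2 \<le> (1 / 2)\<^sup>2"
      by (simp add: abs_le_square_iff[symmetric])
    then show ?thesis by (simp add: power2_eq_square)
  qed
  have "infsum ?f E1 = infsum ?f (E1b G)"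
  proof (rule infsum_cong_neutral)
    show "?f e = 0" if "e \<in> E1 - E1b G" for e
      using that interior by (cases e) blast
  qed (auto simp: E1b_def)
  also have "\<dots> = sum ?f (E1b G)"
    using finite_E1b[OF assms(2)] by simp
  also have "\<dots> \<le> (\<Sum>e\<in>E1b G. 1 / 4)"
    using edge by (intro sum_mono) auto
  also have "\<dots> = card (E1b G) / 4"
    by simp
  also have "\<dots> \<le> boundary_size G / 2"
    using card_E1b_le[OF assms(2)] by simp
  finally show ?thesis
    by (simp add: H_AO_def)
qed

section \<open>Near-optimal slip fields\<close>

lemma near_optimal_slips_mono:
  "\<epsilon> \<le> \<epsilon>' \<Longrightarrow> near_optimal_slips \<Lambda> S G \<epsilon> \<subseteq> near_optimal_slips \<Lambda> S G \<epsilon>'"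
  unfolding near_optimal_slips_def by (fastforce intro: order_trans)

lemma INF_near_optimal_le:
  assumes "transpose S = - S" "bounded G" "G \<subseteq> \<Lambda>" "0 < \<epsilon>"
  shows "(INF \<sigma> \<in> near_optimal_slips \<Lambda> S G \<epsilon>. INF u \<in> displacements \<Lambda>. ereal (H_AO u \<sigma>))
    \<le> ereal (real (boundary_size G) / 8 + \<epsilon>)"
proof -
  let ?A = "UNIV \<times> boundary_slips \<Lambda> G"
  let ?h = "\<lambda>(\<tau>, \<sigma>). H_AO (u_grain S G \<tau>) \<sigma>"
  \<comment> \<open>A real-valued \<open>INF\<close> is a genuine infimum only for a nonempty set
    that is bounded below.\<close>
  have bdd: "bdd_below (?h ` ?A)"
    by (rule bdd_belowI[of _ 0]) (auto simp: H_AO_nonneg)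
  have mem: "(0, rounded_slip G (u_grain S G 0)) \<in> ?A"
    using rounded_slip_in_boundary_slips[OF assms(3)] by simp
  have "(INF p \<in> ?A. ?h p) \<le> real (boundary_size G) / 8"
    using cINF_lower[OF bdd mem] H_AO_rounded_slip_le[OF assms(1,2), of 0] by simp
  \<comment> \<open>The infimum might not be attained; the slack \<epsilon> > 0 supplies a pair
    strictly below it plus \<epsilon>.\<close>
  moreover have "\<exists>p\<in>?A. ?h p < (INF p \<in> ?A. ?h p) + \<epsilon>"
    using cINF_less_iff[OF _ bdd, of "(INF p \<in> ?A. ?h p) + \<epsilon>"] mem \<open>0 < \<epsilon>\<close> by fastforce
  ultimately obtain \<tau> \<sigma> where \<sigma>: "\<sigma> \<in> boundary_slips \<Lambda> G"
    and less: "H_AO (u_grain S G \<tau>) \<sigma> < (INF p \<in> ?A. ?h p) + \<epsilon>"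
    and le: "H_AO (u_grain S G \<tau>) \<sigma> \<le> real (boundary_size G) / 8 + \<epsilon>"
    by fastforce
  have "\<sigma> \<in> near_optimal_slips \<Lambda> S G \<epsilon>"
    using \<sigma> less unfolding near_optimal_slips_def by (auto intro: less_imp_le)
  moreover have "u_grain S G \<tau> \<in> displacements \<Lambda>"
    using \<open>G \<subseteq> \<Lambda>\<close> by (auto simp: displacements_def u_grain_def)
  ultimately show ?thesis
    using le by (intro INF_lower2[of \<sigma>] INF_lower2[of "u_grain S G \<tau>"]) auto
qed

text \<open>\<open>Lim\<close> is a definite description and says nothing before convergence is
  known. Any value below the supremum is exceeded at some \<open>b\<close>, and by antitonicity at
  every smaller positive argument.\<close>

lemma tendsto_at_right_0_antimono:
  fixes f :: "real \<Rightarrow> ereal"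
  assumes "\<And>x y. 0 < x \<Longrightarrow> x \<le> y \<Longrightarrow> f y \<le> f x"
  shows "(f \<longlongrightarrow> (SUP x \<in> {0<..}. f x)) (at_right 0)"
proof (rule increasing_tendsto)
  show "\<forall>\<^sub>F x in at_right 0. f x \<le> (SUP x \<in> {0<..}. f x)"
    using eventually_at_right_less[of 0] by eventually_elim (auto intro: SUP_upper)
next
  fix l assume "l < (SUP x \<in> {0<..}. f x)"
  then obtain b where "0 < b" "l < f b"
    by (auto simp: less_SUP_iff)
  then show "\<forall>\<^sub>F x in at_right 0. l < f x"
    unfolding eventually_at_right_field
    using assms by (meson less_imp_le less_le_trans)
qed

lemma Lim_near_optimal_le:
  assumes "transpose S = - S" "bounded G" "G \<subseteq> \<Lambda>"
  shows "Lim (at_right 0) (\<lambda>\<epsilon>. INF \<sigma> \<in> near_optimal_slips \<Lambda> S G \<epsilon>.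
      INF u \<in> displacements \<Lambda>. ereal (H_AO u \<sigma>)) \<le> ereal (real (boundary_size G) / 8)"
    (is "Lim _ ?f \<le> ?C")
proof -
  let ?l = "SUP \<epsilon> \<in> {0<..}. ?f \<epsilon>"
  have lim: "(?f \<longlongrightarrow> ?l) (at_right 0)"
    by (intro tendsto_at_right_0_antimono INF_superset_mono near_optimal_slips_mono order_refl)
  have "((\<lambda>\<epsilon>. real (boundary_size G) / 8 + \<epsilon>) \<longlongrightarrow> real (boundary_size G) / 8 + 0) (at_right 0)"
    by (intro tendsto_intros)
  then have lim_bound: "((\<lambda>\<epsilon>. ereal (real (boundary_size G) / 8 + \<epsilon>)) \<longlongrightarrow> ?C) (at_right 0)"
    by simp
  \<comment> \<open>The bounds hold for each \<epsilon> > 0 separately; passing to the limit on both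
    sides removes the slack.\<close>
  have "?l \<le> ?C"
  proof (rule tendsto_le[OF _ lim_bound lim])
    show "\<forall>\<^sub>F \<epsilon> in at_right 0. ?f \<epsilon> \<le> ereal (real (boundary_size G) / 8 + \<epsilon>)"
      using eventually_at_right_less[of 0]
      by eventually_elim (rule INF_near_optimal_le[OF assms])
  qed simp
  then show ?thesis
    using tendsto_Lim[OF _ lim] by simp
qed

theorem theorem3p2:
  fixes S :: "real^3^3" and G :: "(real^3) set"
  assumes "transpose S = - S"
    and "G \<subseteq> fcc" and "bounded G" and "nn_connected G"
  shows "optimal_grain_energy G S \<le> ereal (6 * real (boundary_size G))"
proof -
  let ?L = "\<lambda>N. Lim (at_right 0) (\<lambda>\<epsilon>. INF \<sigma> \<in> near_optimal_slips (Lambda_box N) S G \<epsilon>.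
      INF u \<in> displacements (Lambda_box N). ereal (H_AO u \<sigma>))"
  \<comment> \<open>Large \<open>N\<close> suffice for the limit inferior, and for these the box
    contains \<open>G\<close>.\<close>
  have "\<forall>\<^sub>F N in sequentially. ?L N \<le> ereal (6 * real (boundary_size G))"
    using bounded_fcc_subset_Lambda_box[OF assms(2,3)]
  proof eventually_elim
    case (elim N)
    then have "?L N \<le> ereal (real (boundary_size G) / 8)"
      by (rule Lim_near_optimal_le[OF assms(1,3)])
    \<comment> \<open>Rounding gives 1/8 per boundary edge, well below 6.\<close>
    also have "\<dots> \<le> ereal (6 * real (boundary_size G))"
      by simp
    finally show ?case .
  qed
  then have "liminf ?L \<le> liminf (\<lambda>N. ereal (6 * real (boundary_size G)))"
    by (rule Liminf_mono)
  then show ?thesis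
    by (simp add: optimal_grain_energy_def Liminf_const)
qed

end
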